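(* Let $G$ be a connected graph. If each edge of $G$ is $P_4$-inner isometric, then $\mathrm{gp}_{\mathrm d}(G)=0$.
   Context: For a graph $G$ and $X\subseteq V(G)$, vertices $u,v\in V(G)$ are $X$-positionable if for any shortest $u,v$-path $P$ in $G$ we have $V(P)\cap X\subseteq\{u,v\}$. A set $X\subseteq V(G)$ is a dual general position set if every $u,v\in X$ are $X$-positionable and every $u,v\in V(G)\setminus X$ are $X$-positionable. The dual general position number $\mathrm{gp}_{\mathrm d}(G)$ is the cardinality of a largest dual general position set of $G$. A subgraph $G'$ of $G$ is isometric if $d_{G'}(x,y)=d_G(x,y)$ for every two vertices $x,y$ of $G'$, where $d$ denotes the usual shortest-path distance. An edge $e$ of $G$ is called $P_4$-inner isometric if $e$ is the middle edge of some isometric $P_4$ (path on four vertices) of $G$.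
   Formalization: The graph is additionally assumed not to be the one-vertex graph, for which the claim fails: it has no edges, so the condition holds vacuously, but its dual general position number is 1. *)

theory Defs
  imports
    "Graph_Theory.Graph_Theory"
    "HOL-Library.Extended_Nat"
begin

text \<open>
  Simple undirected graphs are modelled as in the AFP entry Graph\_Theory: an undirected edge
  \<open>uv\<close> is a pair of opposite arcs. The following locale is the locale \<open>graph\<close> of that entry
  without finiteness.
\<close>

locale simple_graph = loopfree_digraph + nomulti_digraph + sym_digraph

sublocale graph \<subseteq> simple_graph
  by unfold_locales

definition graph_dist :: "('a, 'b) pre_digraph \<Rightarrow> 'a \<Rightarrow> 'a \<Rightarrow> ereal" where
  "graph_dist G u v = wf_digraph.\<mu> G (\<lambda>_. 1) u v"

definition shortest_path :: "('a, 'b) pre_digraph \<Rightarrow> 'a \<Rightarrow> 'b awalk \<Rightarrow> 'a \<Rightarrow> bool" where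
  "shortest_path G u p v \<longleftrightarrow>
     pre_digraph.apath G u p v \<and> (\<forall>q. pre_digraph.apath G u q v \<longrightarrow> length p \<le> length q)"

definition positionable :: "('a, 'b) pre_digraph \<Rightarrow> 'a set \<Rightarrow> 'a \<Rightarrow> 'a \<Rightarrow> bool" where
  "positionable G X u v \<longleftrightarrow>
     (\<forall>p. shortest_path G u p v \<longrightarrow> set (pre_digraph.awalk_verts G u p) \<inter> X \<subseteq> {u, v})"

definition dual_general_position_set :: "('a, 'b) pre_digraph \<Rightarrow> 'a set \<Rightarrow> bool" where
  "dual_general_position_set G X \<longleftrightarrow>
     X \<subseteq> verts G \<and>
     (\<forall>u\<in>X. \<forall>v\<in>X. positionable G X u v) \<and>
     (\<forall>u\<in>verts G - X. \<forall>v\<in>verts G - X. positionable G X u v)"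

text \<open>
  The values are extended naturals because \<^const>\<open>card\<close> is \<open>0\<close> on infinite sets, which would make
  a vanishing dual general position number meaningless for infinite graphs. For finite graphs the
  supremum is the maximum cardinality, see \<open>gp_d_eq_Max\<close> below.
\<close>

definition gp_d :: "('a, 'b) pre_digraph \<Rightarrow> enat" where
  "gp_d G = (SUP X \<in> {X. dual_general_position_set G X}. if finite X then enat (card X) else \<infinity>)"

definition isometric_subgraph :: "('a, 'b) pre_digraph \<Rightarrow> ('a, 'b) pre_digraph \<Rightarrow> bool" where
  "isometric_subgraph H G \<longleftrightarrow>
     subgraph H G \<and> (\<forall>x\<in>verts H. \<forall>y\<in>verts H. graph_dist H x y = graph_dist G x y)"

text \<open>\<open>H\<close> is the path on four vertices \<open>a - b - c - d\<close>, with middle edge \<open>bc\<close>.\<close>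

definition is_P4 :: "('a, 'b) pre_digraph \<Rightarrow> 'a \<Rightarrow> 'a \<Rightarrow> 'a \<Rightarrow> 'a \<Rightarrow> bool" where
  "is_P4 H a b c d \<longleftrightarrow>
     simple_graph H \<and> distinct [a, b, c, d] \<and> verts H = {a, b, c, d} \<and>
     arcs_ends H = {(a, b), (b, a), (b, c), (c, b), (c, d), (d, c)}"

definition P4_inner_isometric :: "('a, 'b) pre_digraph \<Rightarrow> 'b \<Rightarrow> bool" where
  "P4_inner_isometric G e \<longleftrightarrow>
     (\<exists>H a b c d. isometric_subgraph H G \<and> is_P4 H a b c d \<and>
        e \<in> arcs H \<and> arc_to_ends H e = (b, c))"

lemma dual_general_position_set_empty: "dual_general_position_set G {}"
  by (simp add: dual_general_position_set_def positionable_def)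

lemma gp_d_eq_Max:
  assumes "finite (verts G)"
  shows "gp_d G = enat (Max (card ` {X. dual_general_position_set G X}))"
proof -
  let ?D = "{X. dual_general_position_set G X}"
  have sub: "?D \<subseteq> Pow (verts G)"
    by (auto simp: dual_general_position_set_def)
  then have fin: "finite ?D"
    using assms finite_subset by blast
  have fX: "finite X" if "X \<in> ?D" for X
    using that sub assms finite_subset by blast
  have ne: "card ` ?D \<noteq> {}"
    using dual_general_position_set_empty by auto
  show ?thesis
    unfolding gp_d_def
  proof (rule antisym)
    show "(SUP X\<in>?D. if finite X then enat (card X) else \<infinity>) \<le> enat (Max (card ` ?D))"
      using fX fin by (intro SUP_least) (simp add: Max_ge)
    obtain X where X: "X \<in> ?D" "card X = Max (card ` ?D)"
      using Max_in[OF finite_imageI[OF fin] ne] by fastforce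
    then show "enat (Max (card ` ?D)) \<le> (SUP X\<in>?D. if finite X then enat (card X) else \<infinity>)"
      using fX by (intro SUP_upper2[of X]) auto
  qed
qed

text \<open>The one-vertex graph has no edges, yet its dual general position number is \<open>1\<close>.\<close>

lemma gp_d_single_vertex:
  assumes "verts G = {v}"
  shows "gp_d G = 1"
proof -
  have "positionable G {v} v v"
  proof -
    have "shortest_path G v p v \<Longrightarrow> p = []" for p
      unfolding shortest_path_def using assms
      by (auto simp: pre_digraph.apath_def pre_digraph.awalk_def pre_digraph.cas.simps
            pre_digraph.awalk_verts.simps dest!: spec[of _ "[]"])
    then show ?thesis
      by (auto simp: positionable_def)
  qed
  then have "{X. dual_general_position_set G X} = {{}, {v}}"
    using assms dual_general_position_set_empty[of G]
    by (auto simp: dual_general_position_set_def)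
  then have "Max (card ` {X. dual_general_position_set G X}) = 1"
    by simp
  then show ?thesis
    using gp_d_eq_Max[of G] assms by (simp add: one_enat_def)
qed

end

theory Submission
  imports Defs
begin

text \<open>
  Let \<open>X\<close> be a dual general position set and \<open>bc\<close> the middle edge of an isometric path
  \<open>a - b - c - d\<close>. If \<open>b\<close> and \<open>c\<close> were both in \<open>X\<close>, then the geodesics \<open>abc\<close> and \<open>bcd\<close> would force
  \<open>a\<close> and \<open>d\<close> out of \<open>X\<close>, and the geodesic \<open>abcd\<close> would violate the condition on the complement.
  So \<open>X\<close> is independent. If \<open>b\<close> is in \<open>X\<close>, then its neighbours \<open>a\<close> and \<open>c\<close> are therefore outside
  \<open>X\<close>, and the geodesic \<open>abc\<close> violates the condition on the complement. Hence no vertex of \<open>X\<close> lies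
  on an edge.
\<close>

text \<open>\<open>graph_dist\<close> is an infimum of walk costs, whereas
  \<open>shortest_path\<close> compares lengths of paths. This bound and the next one translate
  between the two.\<close>

lemma (in wf_digraph) graph_dist_le_length:
  assumes "awalk u p v"
  shows "graph_dist G u v \<le> ereal (real (length p))"
  using min_cost_le_walk_cost[OF assms, of "\<lambda>_. 1"]
  by (simp add: graph_dist_def awalk_cost_def sum_list_triv)

lemma (in wf_digraph) length_le_graph_dist:
  assumes "\<And>p. awalk u p v \<Longrightarrow> n \<le> length p"
  shows "ereal (real n) \<le> graph_dist G u v"
  using assms by (auto simp: graph_dist_def \<mu>_def awalk_cost_def sum_list_triv intro!: INF_greatest)

text \<open>Minimality bounds the distance in \<open>H\<close> from below, isometry carries this
  bound to \<open>G\<close>, and no path of \<open>G\<close> is shorter than the distance.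
  Minimality is asked against walks because the infimum ranges over walks.\<close>

lemma shortest_path_isometric:
  assumes iso: "isometric_subgraph H G"
    and path: "pre_digraph.apath H u p v"
    and min: "\<And>q. pre_digraph.awalk H u q v \<Longrightarrow> length p \<le> length q"
  shows "shortest_path G u p v"
proof -
  have sub: "subgraph H G"
    using iso by (simp add: isometric_subgraph_def)
  then interpret G: wf_digraph G
    by (auto simp: subgraph_def)
  interpret H: wf_digraph H
    using sub by (auto simp: subgraph_def)
  have walk: "H.awalk u p v"
    using path by (rule H.awalkI_apath)
  then have uv: "u \<in> verts H" "v \<in> verts H"
    by auto
  have "length p \<le> length q" if "G.apath u q v" for q
  proof -
    have "ereal (real (length p)) \<le> graph_dist H u v"
      using min by (rule H.length_le_graph_dist)
    also have "\<dots> = graph_dist G u v"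
      using iso uv by (simp add: isometric_subgraph_def)
    also have "\<dots> \<le> ereal (real (length q))"
      using that by (intro G.graph_dist_le_length G.awalkI_apath)
    finally show ?thesis
      by simp
  qed
  \<comment> \<open>Vertex lists depend only on the tail and head maps, which \<open>H\<close>
    shares with \<open>G\<close>, so distinctness of the vertices carries over.\<close>
  moreover have "G.awalk_verts u p = H.awalk_verts u p"
    using sub by (auto simp: subgraph_def compatible_def G.awalk_verts_conv H.awalk_verts_conv)
  then have "G.apath u p v"
    using path G.subgraph_awalk_imp_awalk[OF walk sub] by (simp add: G.apath_def H.apath_def)
  ultimately show ?thesis
    by (simp add: shortest_path_def)
qed

text \<open>A potential that rises by at most one per arc certifies a lower bound on the length of
  walks.\<close>

lemma (in wf_digraph) awalk_potential_le:
  fixes h :: "'a \<Rightarrow> nat"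
  assumes "awalk u p v" and "\<And>x y. x \<rightarrow>\<^bsub>G\<^esub> y \<Longrightarrow> h y \<le> h x + 1"
  shows "h v \<le> h u + length p"
  using assms(1)
proof (induction p arbitrary: u)
  case (Cons e p)
  then have "e \<in> arcs G" "u = tail G e" "h v \<le> h (head G e) + length p"
    by (auto simp: awalk_Cons_iff)
  moreover from this have "h (head G e) \<le> h u + 1"
    using assms(2)[of "tail G e" "head G e"] by (auto intro: in_arcs_imp_in_arcs_ends)
  ultimately show ?case
    by simp
qed (simp add: awalk_Nil_iff)

lemma isometric_P4_not_positionable:
  assumes iso: "isometric_subgraph H G" and P4: "is_P4 H a b c d"
  shows "b \<in> X \<Longrightarrow> \<not> positionable G X a c"
    and "c \<in> X \<Longrightarrow> \<not> positionable G X b d"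
    and "b \<in> X \<Longrightarrow> \<not> positionable G X a d"
proof -
  have sub: "subgraph H G"
    using iso by (simp add: isometric_subgraph_def)
  interpret H: wf_digraph H
    using sub by (auto simp: subgraph_def)
  have dist: "distinct [a, b, c, d]"
    and ends: "arcs_ends H = {(a, b), (b, a), (b, c), (c, b), (c, d), (d, c)}"
    using P4 by (auto simp: is_P4_def)
  have "(a, b) \<in> arcs_ends H" "(b, c) \<in> arcs_ends H" "(c, d) \<in> arcs_ends H"
    using ends by auto
  then obtain e f g
    where e: "e \<in> arcs H" "tail H e = a" "head H e = b"
      and f: "f \<in> arcs H" "tail H f = b" "head H f = c"
      and g: "g \<in> arcs H" "tail H g = c" "head H g = d"
    by (meson reachableE)
  \<comment> \<open>The position along the path serves as the potential: a path in \<open>H\<close>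
    whose length equals the rise of \<open>h\<close> is shortest.\<close>
  define h :: "'a \<Rightarrow> nat"
    where "h x = (if x = a then 0 else if x = b then 1 else if x = c then 2 else 3)" for x
  have h: "h a = 0" "h b = 1" "h c = 2" "h d = 3"
    using dist by (auto simp: h_def)
  have step: "h y \<le> h x + 1" if "x \<rightarrow>\<^bsub>H\<^esub> y" for x y
    using that h by (auto simp: ends)
  have sp: "shortest_path G u p v" if "H.apath u p v" "h v = h u + length p" for u p v
  proof (rule shortest_path_isometric[OF iso that(1)])
    fix q
    assume "H.awalk u q v"
    from H.awalk_potential_le[of u q v h, OF this step] that(2) show "length p \<le> length q"
      by simp
  qed
  have tail: "tail G = tail H"
    using sub by (auto simp: subgraph_def compatible_def)
  have verts: "c \<in> verts H" "d \<in> verts H"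
    using P4 by (auto simp: is_P4_def)
  \<comment> \<open>An inner vertex of a path is the tail of one of its arcs, so the violating
    vertex can be read off from the arc list.\<close>
  have notin: "\<not> positionable G X u v"
    if "shortest_path G u p v" "w \<in> tail G ` set p" "w \<in> X" "w \<notin> {u, v}" for u p v w
  proof -
    have "tail G ` set p \<subseteq> set (pre_digraph.awalk_verts G u p)"
      by (auto simp: pre_digraph.awalk_verts_conv)
    with that show ?thesis
      unfolding positionable_def by blast
  qed
  have "H.apath a [e, f] c" "H.apath b [f, g] d" "H.apath a [e, f, g] d"
    using e f g verts dist by (simp_all add: H.apath_Cons_iff H.apath_Nil_iff)
  then have "shortest_path G a [e, f] c" "shortest_path G b [f, g] d"
    "shortest_path G a [e, f, g] d"
    by (simp_all add: sp h)
  note paths = this[THEN notin]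
  show "\<not> positionable G X a c" if "b \<in> X"
    by (rule paths(1)[of b]) (use e f g dist dist[THEN distinct_rev[THEN iffD2]] that in \<open>simp_all add: tail\<close>)
  show "\<not> positionable G X b d" if "c \<in> X"
    by (rule paths(2)[of c]) (use e f g dist dist[THEN distinct_rev[THEN iffD2]] that in \<open>simp_all add: tail\<close>)
  show "\<not> positionable G X a d" if "b \<in> X"
    by (rule paths(3)[of b]) (use e f g dist dist[THEN distinct_rev[THEN iffD2]] that in \<open>simp_all add: tail\<close>)
qed

text \<open>Tails suffice for the theorem: in a symmetric digraph every vertex on an arc is the tail
  of one.\<close>

lemma dual_general_position_set_tail_notin:
  assumes inner: "\<forall>e\<in>arcs G. P4_inner_isometric G e"
    and X: "dual_general_position_set G X" and e: "e \<in> arcs G"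
  shows "tail G e \<notin> X"
proof
  assume tX: "tail G e \<in> X"
  have P4: "\<exists>H a d. isometric_subgraph H G \<and> is_P4 H a (tail G e) (head G e) d"
    if "e \<in> arcs G" for e
  proof -
    from inner that obtain H a b c d where "isometric_subgraph H G" "is_P4 H a b c d"
      "arc_to_ends H e = (b, c)"
      unfolding P4_inner_isometric_def by blast
    then show ?thesis
      by (auto simp: isometric_subgraph_def subgraph_def compatible_def arc_to_ends_def)
  qed
  have in_X: "positionable G X u v" if "u \<in> X" "v \<in> X" for u v
    using X that by (simp add: dual_general_position_set_def)
  have out_X: "positionable G X u v" if "u \<in> verts G - X" "v \<in> verts G - X" for u v
    using X that by (simp add: dual_general_position_set_def)
  have verts: "{a, b, c, d} \<subseteq> verts G" if "isometric_subgraph H G" "is_P4 H a b c d" for H a b c d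
    using that by (auto simp: isometric_subgraph_def subgraph_def is_P4_def)
  have indep: "\<not> (tail G e \<in> X \<and> head G e \<in> X)" if eG: "e \<in> arcs G" for e
  proof
    assume *: "tail G e \<in> X \<and> head G e \<in> X"
    from P4[OF eG] obtain H a d
      where H: "isometric_subgraph H G" "is_P4 H a (tail G e) (head G e) d"
      by blast
    have "a \<notin> X" "d \<notin> X"
      using isometric_P4_not_positionable[OF H, of X] in_X * by blast+
    then show False
      using isometric_P4_not_positionable(3)[OF H, of X] out_X verts[OF H] * by blast
  qed
  from P4[OF e] obtain H a d
    where H: "isometric_subgraph H G" "is_P4 H a (tail G e) (head G e) d"
    by blast
  \<comment> \<open>The outer edge of the path is itself an arc of \<open>G\<close>, so independence
    applies to it as well as to \<open>e\<close>.\<close>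
  then have "(a, tail G e) \<in> arcs_ends H"
    by (simp add: is_P4_def)
  then obtain e' where "e' \<in> arcs G" "tail G e' = a" "head G e' = tail G e"
    using H(1) by (force simp: isometric_subgraph_def subgraph_def compatible_def)
  then have "a \<notin> X" "head G e \<notin> X"
    using indep e tX by force+
  then show False
    using isometric_P4_not_positionable(1)[OF H, of X] out_X verts[OF H] tX by blast
qed

theorem proposition3p3:
  fixes G :: "('a, 'b) pre_digraph"
  assumes "simple_graph G"
    and "Digraph_Component.connected G"
    and "\<nexists>v. verts G = {v}"
    and "\<forall>e\<in>arcs G. P4_inner_isometric G e"
  shows "gp_d G = 0"
proof -
  interpret simple_graph G
    by (rule assms(1))
  have "verts G \<noteq> {}"
    using assms(2) by (simp add: connected_conv)
  \<comment> \<open>A connected digraph without arcs is a single vertex, the excluded case, where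
    \<open>gp_d\<close> is 1.\<close>
  then have "arcs G \<noteq> {}"
    using connected_arcs_empty[OF assms(2)] assms(3) by blast
  then have "verts G = tail G ` arcs G \<union> head G ` arcs G"
    using connected_verts assms(2) by blast
  also have "\<dots> \<subseteq> tail G ` arcs G"
    using sym_arcs by (auto simp: symmetric_conv)
  finally have verts: "verts G \<subseteq> tail G ` arcs G" .
  have "X = {}" if "dual_general_position_set G X" for X
  proof -
    have "X \<subseteq> verts G"
      using that by (simp add: dual_general_position_set_def)
    then show ?thesis
      using verts dual_general_position_set_tail_notin[OF assms(4) that] by blast
  qed
  then have "{X. dual_general_position_set G X} = {{}}"
    using dual_general_position_set_empty by auto
  then show ?thesis
    by (simp add: gp_d_def zero_enat_def)
qed

end
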